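(* Fix a subcarrier $n$ and consider the downlink model of the context with maximum-ratio (MR) precoding, i.e. $\mathbf{t}_{\mathrm{c},i}[n]=\sqrt{\alpha_{i,n}/M_t}\,\bar{\mathbf{g}}_i[n]$ for $i=1,\dots,K$. Then for every user $k\in\{1,\dots,K\}$ the use-and-then-forget (UatF) effective SINR of user $k$ on subcarrier $n$ equals $$\mathrm{SINR}^{\mathrm{eff,MR}}_{k,n}=\frac{M_t\,\eta_k\,\rho_{k,n}\alpha_{k,n}}{\xi_k\sum_{i=1}^{K}\rho_{i,n}\alpha_{i,n}+\xi_k\,\rho_n^{\mathrm{sen}}q_n+\sigma_{k,n}^2}.$$
   Context: A base station with $M_t\ge 1$ antennas serves $K\ge 1$ single-antenna users. On subcarrier $n$: $\rho_{k,n}\in\{0,1\}$ indicates whether user $k$ is scheduled, $\rho_n^{\mathrm{sen}}\in\{0,1\}$ indicates whether sensing is active, $\alpha_{k,n}\ge 0$ is the communication power of user $k$, $q_n\ge 0$ is the sensing power, and $\mathbf{w}\in\mathbb{C}^{M_t}$ is a deterministic sensing beamformer with $\|\mathbf{w}\|_2=1$. Channels: the channel of user $k$ is $\mathbf{g}_k[n]=\widehat{\mathbf{g}}_k[n]+\mathbf{e}_k[n]\in\mathbb{C}^{M_t}$, where $\widehat{\mathbf{g}}_k[n]=\sqrt{\eta_k}\,\bar{\mathbf{g}}_k[n]$, $\bar{\mathbf{g}}_k[n]\sim\mathcal{CN}(\mathbf{0},\mathbf{I}_{M_t})$, $\mathbf{e}_k[n]\sim\mathcal{CN}(\mathbf{0},\varepsilon_k\mathbf{I}_{M_t})$,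 with $\eta_k>0$, $\varepsilon_k\ge 0$ and $\xi_k=\eta_k+\varepsilon_k$. All the vectors $\bar{\mathbf{g}}_1[n],\dots,\bar{\mathbf{g}}_K[n],\mathbf{e}_1[n],\dots,\mathbf{e}_K[n]$ are mutually independent. Here $\mathcal{CN}$ denotes the circularly symmetric complex Gaussian distribution. Signal: the transmitted vector is $\mathbf{x}=\sum_{i=1}^K \rho_{i,n}\mathbf{t}_{\mathrm{c},i}[n]s_i+\sqrt{q_n\rho_n^{\mathrm{sen}}}\,\mathbf{w}\,s^{\mathrm{sen}}$ with unit-power data symbols $s_i$ and sensing symbol $s^{\mathrm{sen}}$, and user $k$ receives $\mathbf{g}_k^H[n]\mathbf{x}+v_k$ with noise $v_k\sim\mathcal{CN}(0,\sigma_{k,n}^2)$, $\sigma_{k,n}^2>0$. UatF effective SINR: with $A_k=\rho_{k,n}\mathbf{g}_k^H[n]\mathbf{t}_{\mathrm{c},k}[n]$, $B_{k,i}=\rho_{i,n}\mathbf{g}_k^H[n]\mathbf{t}_{\mathrm{c},i}[n]$ for $i\ne k$, and $C_k=\sqrt{q_n\rho_n^{\mathrm{sen}}}\,\mathbf{g}_k^H[n]\mathbf{w}$, it is defined as $$\mathrm{SINR}^{\mathrm{eff}}_{k,n}=\frac{|\mathbb{E}[A_k]|^2}{\mathbb{E}[|A_k|^2]-|\mathbb{E}[A_k]|^2+\sum_{i\ne k}\mathbb{E}[|B_{k,i}|^2]+\mathbb{E}[|C_k|^2]+\sigma_{k,n}^2},$$ with expectations over the random channels (channel estimates and errors). *)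

theory Defs
  imports "HOL-Probability.Probability"
begin

definition gaussian_law :: "real measure \<Rightarrow> bool" where
  "gaussian_law N \<longleftrightarrow>
     (\<exists>m. N = return borel m) \<or>
     (\<exists>m s. s > 0 \<and> N = density lborel (normal_density m s))"

(* The real inner product on complex^'m is a . x = (SUM i. Re (a$i) * Re (x$i) + Im (a$i) * Im (x$i)),
   so the condition says that the real and imaginary parts of all entries are jointly Gaussian. *)
definition gaussian_vector :: "'a measure \<Rightarrow> ('a \<Rightarrow> 'b::euclidean_space) \<Rightarrow> bool" where
  "gaussian_vector M X \<longleftrightarrow>
     X \<in> borel_measurable M \<and> (\<forall>a. gaussian_law (distr M borel (\<lambda>\<omega>. a \<bullet> X \<omega>)))"

(* X ~ CN(0, \<Gamma>). Rotation by pi already forces mean zero, so the covariance is E[X X^H].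
   Singular \<Gamma>, including \<Gamma> = 0, is allowed. *)
definition circ_complex_normal ::
  "'a measure \<Rightarrow> complex^'m^'m \<Rightarrow> ('a \<Rightarrow> complex^'m) \<Rightarrow> bool" where
  "circ_complex_normal M \<Gamma> X \<longleftrightarrow>
     gaussian_vector M X \<and>
     (\<forall>\<phi>. distr M borel (\<lambda>\<omega>. cis \<phi> *s X \<omega>) = distr M borel X) \<and>
     (\<forall>i j. (LINT \<omega>|M. X \<omega> $ i * cnj (X \<omega> $ j)) = \<Gamma> $ i $ j)"

(* x^H y; the library inner product on complex^'m is only its real part *)
definition herm_prod :: "complex^'m \<Rightarrow> complex^'m \<Rightarrow> complex" where
  "herm_prod x y = (\<Sum>j\<in>UNIV. cnj (x $ j) * y $ j)"

definition channel_estimate ::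
  "('k \<Rightarrow> real) \<Rightarrow> ('k \<Rightarrow> 'a \<Rightarrow> complex^'m) \<Rightarrow> 'k \<Rightarrow> 'a \<Rightarrow> complex^'m" where
  "channel_estimate \<eta> gbar k \<omega> = sqrt (\<eta> k) *\<^sub>R gbar k \<omega>"

definition channel ::
  "('k \<Rightarrow> real) \<Rightarrow> ('k \<Rightarrow> 'a \<Rightarrow> complex^'m) \<Rightarrow> ('k \<Rightarrow> 'a \<Rightarrow> complex^'m) \<Rightarrow> 'k \<Rightarrow> 'a \<Rightarrow> complex^'m" where
  "channel \<eta> gbar e k \<omega> = channel_estimate \<eta> gbar k \<omega> + e k \<omega>"

definition mr_precoder ::
  "('k \<Rightarrow> real) \<Rightarrow> ('k \<Rightarrow> 'a \<Rightarrow> complex^'m) \<Rightarrow> 'k \<Rightarrow> 'a \<Rightarrow> complex^'m" where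
  "mr_precoder \<alpha> gbar i \<omega> = sqrt (\<alpha> i / real CARD('m)) *\<^sub>R gbar i \<omega>"

(* Coefficient of the data symbol of user i in the signal received by user k:
   A_k for i = k, B_{k,i} for i \<noteq> k. *)
definition comm_gain ::
  "('k \<Rightarrow> real) \<Rightarrow> ('k \<Rightarrow> 'a \<Rightarrow> complex^'m) \<Rightarrow> ('k \<Rightarrow> 'a \<Rightarrow> complex^'m) \<Rightarrow> 'k \<Rightarrow> 'k \<Rightarrow> 'a \<Rightarrow> complex" where
  "comm_gain \<rho> g t k i \<omega> = of_real (\<rho> i) * herm_prod (g k \<omega>) (t i \<omega>)"

(* Coefficient of the sensing symbol in the signal received by user k: C_k. *)
definition sensing_gain ::
  "real \<Rightarrow> real \<Rightarrow> complex^'m \<Rightarrow> ('k \<Rightarrow> 'a \<Rightarrow> complex^'m) \<Rightarrow> 'k \<Rightarrow> 'a \<Rightarrow> complex" where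
  "sensing_gain \<rho>sen q w g k \<omega> = of_real (sqrt (q * \<rho>sen)) * herm_prod (g k \<omega>) w"

definition uatf_sinr ::
  "'a measure \<Rightarrow> ('k::finite \<Rightarrow> real) \<Rightarrow> real \<Rightarrow> real \<Rightarrow> complex^'m \<Rightarrow> ('k \<Rightarrow> real)
     \<Rightarrow> ('k \<Rightarrow> 'a \<Rightarrow> complex^'m) \<Rightarrow> ('k \<Rightarrow> 'a \<Rightarrow> complex^'m) \<Rightarrow> 'k \<Rightarrow> real" where
  "uatf_sinr M \<rho> \<rho>sen q w \<sigma> g t k =
     (let A = comm_gain \<rho> g t k k;
          B = comm_gain \<rho> g t k;
          C = sensing_gain \<rho>sen q w g k
      in (cmod (LINT \<omega>|M. A \<omega>))\<^sup>2 /
         ((LINT \<omega>|M. (cmod (A \<omega>))\<^sup>2) - (cmod (LINT \<omega>|M. A \<omega>))\<^sup>2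
          + (\<Sum>i\<in>UNIV - {k}. LINT \<omega>|M. (cmod (B i \<omega>))\<^sup>2)
          + (LINT \<omega>|M. (cmod (C \<omega>))\<^sup>2)
          + (\<sigma> k)\<^sup>2))"

end

theory Submission
  imports Defs
begin

text \<open>Write \<open>h\<close> for the channel of user \<open>k\<close>. The interference and sensing terms depend only on
its covariance \<open>\<xi>\<^sub>k I\<close>: if \<open>Y\<close> is independent of \<open>h\<close>, then \<open>E|h\<^sup>H Y|\<^sup>2 = \<xi>\<^sub>k E\<parallel>Y\<parallel>\<^sup>2\<close>.
The desired signal correlates \<open>h\<close> with its own estimate and needs \<open>E\<parallel>X\<parallel>\<^sup>4 = m (m + 1)\<close> for \<open>X \<sim> CN(0, I)\<close>. To get this from the law of the scalar
projections only, invariance under rotation by \<open>i\<close> gives \<open>a \<bullet> X\<close> the variance \<open>\<parallel>a\<parallel>\<^sup>2 / 2\<close>, hence the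
fourth moment \<open>3 \<parallel>a\<parallel>\<^sup>4 / 4\<close>, and polarization yields the mixed moments \<open>E (a \<bullet> X)\<^sup>2 (b \<bullet> X)\<^sup>2\<close>.\<close>

section \<open>Moments of centered one-dimensional Gaussian laws\<close>

lemma gaussian_law_centered_moments:
  assumes N: "gaussian_law N" and mean: "(LINT x|N. x) = 0"
  shows "integrable N (\<lambda>x. x ^ n)"
    and "(LINT x|N. x ^ 4) = 3 * (LINT x|N. x\<^sup>2)\<^sup>2"
proof -
  \<comment> \<open>Mean zero forces the location parameter to be 0 in the degenerate case as well
    as in the density case.\<close>
  consider "N = return borel 0" | s where "s > 0" "N = density lborel (normal_density 0 s)"
    using N unfolding gaussian_law_def
  proof (elim disjE exE conjE)
    fix m assume "N = return borel m"
    with mean have "m = 0" by (simp add: integral_return)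
    then show ?thesis using \<open>N = return borel m\<close> that by simp
  next
    fix m s :: real assume s: "s > 0" and Nd: "N = density lborel (normal_density m s)"
    then have "m = 0"
      using mean s by (simp add: integral_density integral_normal_moment_nz_1)
    then show ?thesis using s Nd that by simp
  qed
  note cs = this
  show "integrable N (\<lambda>x. x ^ n)"
    using cs
  proof cases
    case 1
    interpret prob_space N unfolding 1 by (rule prob_space_return) simp
    have "AE x in N. x = 0" unfolding 1 by (simp add: AE_return)
    then show ?thesis
      by (intro integrable_const_bound[where B="0 ^ n"]) (auto simp: 1)
  next
    case 2
    then show ?thesis
      using integrable_normal_moment[of s 0 n] by (simp add: integrable_density)
  qed
  show "(LINT x|N. x ^ 4) = 3 * (LINT x|N. x\<^sup>2)\<^sup>2"
    using cs
  proof cases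
    case 1
    then show ?thesis by (simp add: integral_return)
  next
    case 2
    \<comment> \<open>The even normal moments of order 2 and 4 are \<open>s ^ 2\<close> and
      \<open>3 * s ^ 4\<close>.\<close>
    then show ?thesis
      using integral_normal_moment_even[of s 0 1] integral_normal_moment_even[of s 0 2]
      by (simp add: integral_density fact_numeral field_simps power2_eq_square)
  qed
qed

section \<open>Algebra of the Hermitian product\<close>

lemma inner_eq_Re_herm_prod: "a \<bullet> x = Re (herm_prod a x)"
  for a x :: "complex^'m"
  by (simp add: herm_prod_def inner_vec_def inner_complex_def)

lemma herm_prod_scale_right: "herm_prod x (c *s y) = c * herm_prod x y"
  by (simp add: herm_prod_def sum_distrib_left algebra_simps)

lemma herm_prod_scaleR_left: "herm_prod (r *\<^sub>R x) y = of_real r * herm_prod x y"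
  by (simp add: herm_prod_def sum_distrib_left mult.assoc scaleR_conv_of_real[where 'a=complex])

lemma herm_prod_scaleR_right: "herm_prod x (r *\<^sub>R y) = of_real r * herm_prod x y"
  by (simp add: herm_prod_def sum_distrib_left scaleR_conv_of_real[where 'a=complex] algebra_simps)

lemma herm_prod_add_left: "herm_prod (x + y) z = herm_prod x z + herm_prod y z"
  by (simp add: herm_prod_def sum.distrib algebra_simps)

lemma herm_prod_commute: "herm_prod y x = cnj (herm_prod x y)"
  by (simp add: herm_prod_def mult.commute)

lemma norm_power2_vec: "(norm x)\<^sup>2 = (\<Sum>j\<in>UNIV. (norm (x $ j))\<^sup>2)"
  by (simp add: norm_vec_def L2_set_def sum_nonneg)

lemma herm_prod_self: "herm_prod x x = of_real ((norm x)\<^sup>2)"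
  unfolding norm_power2_vec herm_prod_def
  by (simp add: mult.commute[of "cnj _"] complex_mult_cnj cmod_power2)

text \<open>Each summand is grouped as an entry of x x^H times an entry of y y^H, so that
  expectations separate when one vector is constant or the two are independent.\<close>

lemma cmod_herm_prod_squared:
  "of_real ((cmod (herm_prod x y))\<^sup>2) =
    (\<Sum>i\<in>UNIV. \<Sum>j\<in>UNIV. (x $ j * cnj (x $ i)) * (y $ i * cnj (y $ j)))"
proof -
  have "of_real ((cmod (herm_prod x y))\<^sup>2) = herm_prod x y * cnj (herm_prod x y)"
    by (rule complex_norm_square)
  also have "\<dots> = (\<Sum>i\<in>UNIV. \<Sum>j\<in>UNIV. (cnj (x $ i) * y $ i) * (x $ j * cnj (y $ j)))"
    by (simp add: herm_prod_def sum_product)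
  finally show ?thesis by (simp add: algebra_simps)
qed

lemma borel_measurable_vec_nth [measurable]:
  "(\<lambda>x. x $ i) \<in> borel_measurable borel" for i :: "'n::finite"
  by (intro borel_measurable_continuous_onI continuous_intros)

lemma borel_measurable_cnj [measurable]: "cnj \<in> borel_measurable borel"
  by (intro borel_measurable_continuous_onI continuous_intros)

context prob_space
begin

section \<open>Integrability criteria on a probability space\<close>

lemma integrable_norm_power_le:
  fixes X :: "'a \<Rightarrow> 'b::{second_countable_topology, banach}"
  assumes [measurable]: "X \<in> borel_measurable M"
    and int: "integrable M (\<lambda>\<omega>. (norm (X \<omega>)) ^ n)" and "k \<le> n"
  shows "integrable M (\<lambda>\<omega>. (norm (X \<omega>)) ^ k)"
proof (rule Bochner_Integration.integrable_bound)
  show "integrable M (\<lambda>\<omega>. 1 + (norm (X \<omega>)) ^ n)" using int by simp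
  have "x ^ k \<le> 1 + x ^ n" if "x \<ge> 0" for x :: real
  proof (cases "x \<le> 1")
    case True
    then have "x ^ k \<le> 1" using that by (simp add: power_le_one)
    also have "\<dots> \<le> 1 + x ^ n" using that by simp
    finally show ?thesis .
  next
    case False
    then have "x ^ k \<le> x ^ n" using \<open>k \<le> n\<close> by (intro power_increasing) auto
    then show ?thesis by simp
  qed
  then show "AE \<omega> in M. norm ((norm (X \<omega>)) ^ k) \<le> norm (1 + (norm (X \<omega>)) ^ n)"
    by (auto intro: order_trans)
qed simp

lemma integrable_mult_of_squares:
  fixes U V :: "'a \<Rightarrow> 'b::{second_countable_topology, banach, real_normed_algebra}"
  assumes [measurable]: "U \<in> borel_measurable M" "V \<in> borel_measurable M"
    and U: "integrable M (\<lambda>\<omega>. (norm (U \<omega>))\<^sup>2)" and V: "integrable M (\<lambda>\<omega>. (norm (V \<omega>))\<^sup>2)"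
  shows "integrable M (\<lambda>\<omega>. U \<omega> * V \<omega>)"
proof (rule Bochner_Integration.integrable_bound)
  show "integrable M (\<lambda>\<omega>. (norm (U \<omega>))\<^sup>2 + (norm (V \<omega>))\<^sup>2)" using U V by simp
  have "norm (u * v) \<le> (norm u)\<^sup>2 + (norm v)\<^sup>2" for u v :: 'b
  proof -
    have "norm (u * v) \<le> norm u * norm v" by (rule norm_mult_ineq)
    also have "\<dots> \<le> 2 * norm u * norm v" by simp
    also have "\<dots> \<le> (norm u)\<^sup>2 + (norm v)\<^sup>2" by (rule sum_squares_bound)
    finally show ?thesis .
  qed
  then show "AE \<omega> in M. norm (U \<omega> * V \<omega>) \<le> norm ((norm (U \<omega>))\<^sup>2 + (norm (V \<omega>))\<^sup>2)"
    by auto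
qed simp

section \<open>Circular complex normal vectors: rotations, projections, norm powers\<close>

lemma circ_complex_normal_measurable:
  "circ_complex_normal M \<Gamma> X \<Longrightarrow> X \<in> borel_measurable M"
  by (simp add: circ_complex_normal_def gaussian_vector_def)

lemma circ_complex_normal_rotate:
  fixes f :: "complex^'m \<Rightarrow> 'b::{second_countable_topology, banach}"
  assumes X: "circ_complex_normal M \<Gamma> X" and [measurable]: "f \<in> borel_measurable borel"
  shows "(LINT \<omega>|M. f (cis \<phi> *s X \<omega>)) = (LINT \<omega>|M. f (X \<omega>))"
proof -
  note [measurable] = circ_complex_normal_measurable[OF X]
  \<comment> \<open>Written coordinatewise, the rotation is visibly continuous, hence Borel.\<close>
  have "cis \<phi> *s X \<omega> = (\<chi> i. cis \<phi> * X \<omega> $ i)" for \<omega> by (simp add: vec_eq_iff)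
  moreover have "(\<lambda>x::complex^'m. (\<chi> i. cis \<phi> * x $ i)) \<in> borel_measurable borel"
    by (intro borel_measurable_continuous_onI continuous_intros)
  ultimately have [measurable]: "(\<lambda>\<omega>. cis \<phi> *s X \<omega>) \<in> borel_measurable M"
    using measurable_compose[OF circ_complex_normal_measurable[OF X]] by simp
  have "(LINT \<omega>|M. f (cis \<phi> *s X \<omega>)) = (LINT x|distr M borel (\<lambda>\<omega>. cis \<phi> *s X \<omega>). f x)"
    by (simp add: integral_distr)
  also have "distr M borel (\<lambda>\<omega>. cis \<phi> *s X \<omega>) = distr M borel X"
    using X by (simp add: circ_complex_normal_def)
  finally show ?thesis by (simp add: integral_distr)
qed

text \<open>Rotation by pi maps X to -X, so the mean equals its own negative.\<close>

lemma circ_complex_normal_inner_mean: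
  assumes X: "circ_complex_normal M \<Gamma> X"
  shows "(LINT \<omega>|M. a \<bullet> X \<omega>) = 0"
proof -
  have "cis pi *s X \<omega> = - X \<omega>" for \<omega> by (simp add: vec_eq_iff)
  then show ?thesis
    using circ_complex_normal_rotate[OF X, of "\<lambda>x. a \<bullet> x" pi] by simp
qed

lemma circ_complex_normal_nth_mean:
  assumes X: "circ_complex_normal M \<Gamma> X"
  shows "(LINT \<omega>|M. X \<omega> $ i) = 0"
proof -
  have "cis pi *s X \<omega> = - X \<omega>" for \<omega> by (simp add: vec_eq_iff)
  then show ?thesis
    using circ_complex_normal_rotate[OF X, of "\<lambda>x. x $ i" pi] by simp
qed

text \<open>The projection has a Gaussian law by definition, and its mean vanishes by rotation, so
  the scalar facts transfer through \<open>distr\<close>.\<close>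

lemma circ_complex_normal_inner_moments:
  assumes X: "circ_complex_normal M \<Gamma> X"
  shows "integrable M (\<lambda>\<omega>. (a \<bullet> X \<omega>) ^ n)"
    and "(LINT \<omega>|M. (a \<bullet> X \<omega>) ^ 4) = 3 * (LINT \<omega>|M. (a \<bullet> X \<omega>)\<^sup>2)\<^sup>2"
proof -
  note [measurable] = circ_complex_normal_measurable[OF X]
  have "gaussian_law (distr M borel (\<lambda>\<omega>. a \<bullet> X \<omega>))"
    using X by (simp add: circ_complex_normal_def gaussian_vector_def)
  moreover have "(LINT x|distr M borel (\<lambda>\<omega>. a \<bullet> X \<omega>). x) = 0"
    using circ_complex_normal_inner_mean[OF X, of a] by (simp add: integral_distr)
  ultimately have "integrable (distr M borel (\<lambda>\<omega>. a \<bullet> X \<omega>)) (\<lambda>x. x ^ n)"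
    and *: "(LINT x|distr M borel (\<lambda>\<omega>. a \<bullet> X \<omega>). x ^ 4)
        = 3 * (LINT x|distr M borel (\<lambda>\<omega>. a \<bullet> X \<omega>). x\<^sup>2)\<^sup>2"
    using gaussian_law_centered_moments by blast+
  then show "integrable M (\<lambda>\<omega>. (a \<bullet> X \<omega>) ^ n)"
    by (subst (asm) integrable_distr_eq) auto
  show "(LINT \<omega>|M. (a \<bullet> X \<omega>) ^ 4) = 3 * (LINT \<omega>|M. (a \<bullet> X \<omega>)\<^sup>2)\<^sup>2"
    using * by (simp add: integral_distr)
qed

text \<open>Squaring the Parseval identity reduces the fourth moment of the norm to mixed moments of
  pairs of real projections.\<close>

lemma norm_power4_eq_sum:
  "(norm x) ^ 4 = (\<Sum>b\<in>Basis. \<Sum>c\<in>Basis. (b \<bullet> x)\<^sup>2 * (c \<bullet> x)\<^sup>2)"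
  for x :: "'b::euclidean_space"
proof -
  have "(norm x)\<^sup>2 = (\<Sum>b\<in>Basis. (b \<bullet> x)\<^sup>2)"
    unfolding power2_norm_eq_inner
    by (subst euclidean_inner) (simp add: power2_eq_square inner_commute)
  then have "((norm x)\<^sup>2)\<^sup>2 = (\<Sum>b\<in>Basis. \<Sum>c\<in>Basis. (b \<bullet> x)\<^sup>2 * (c \<bullet> x)\<^sup>2)"
    by (simp add: power2_eq_square[of "sum _ _"] sum_product)
  then show ?thesis by simp
qed

lemma circ_complex_normal_integrable_inner_squares:
  assumes X: "circ_complex_normal M \<Gamma> X"
  shows "integrable M (\<lambda>\<omega>. (b \<bullet> X \<omega>)\<^sup>2 * (c \<bullet> X \<omega>)\<^sup>2)"
proof -
  note [measurable] = circ_complex_normal_measurable[OF X]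
  show ?thesis
    using circ_complex_normal_inner_moments(1)[OF X, of _ 4]
    by (intro integrable_mult_of_squares) simp_all
qed

lemma circ_complex_normal_integrable_norm_power:
  assumes X: "circ_complex_normal M \<Gamma> X" and "n \<le> 4"
  shows "integrable M (\<lambda>\<omega>. (norm (X \<omega>)) ^ n)"
proof -
  have "integrable M (\<lambda>\<omega>. (norm (X \<omega>)) ^ 4)"
    unfolding norm_power4_eq_sum
    by (intro Bochner_Integration.integrable_sum circ_complex_normal_integrable_inner_squares[OF X])
  then show ?thesis
    using integrable_norm_power_le[OF circ_complex_normal_measurable[OF X]] \<open>n \<le> 4\<close> by blast
qed

section \<open>Isotropic covariance and the moments derived from it\<close>

text \<open>Only second-order information is kept, without Gaussianity: the channel, a sum of
  independent vectors, can then be handled without showing that it is Gaussian. Square integrability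
  is a separate clause because the integral of a non-integrable function is 0 by convention, so the
  covariance equations alone would not secure it.\<close>

definition isotropic :: "real \<Rightarrow> ('a \<Rightarrow> complex^'m) \<Rightarrow> bool" where
  "isotropic c X \<longleftrightarrow> X \<in> borel_measurable M \<and> integrable M (\<lambda>\<omega>. (norm (X \<omega>))\<^sup>2) \<and>
     (\<forall>i j. (LINT \<omega>|M. X \<omega> $ i * cnj (X \<omega> $ j)) = (if i = j then of_real c else 0))"

lemma circ_complex_normal_isotropic:
  assumes X: "circ_complex_normal M (mat (complex_of_real c)) X"
  shows "isotropic c X"
  using circ_complex_normal_integrable_norm_power[OF X, of 2] circ_complex_normal_measurable[OF X] X
  by (simp add: isotropic_def circ_complex_normal_def mat_def)

lemma square_integrable_nth:
  fixes X :: "'a \<Rightarrow> complex^'m"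
  assumes [measurable]: "X \<in> borel_measurable M"
    and int: "integrable M (\<lambda>\<omega>. (norm (X \<omega>))\<^sup>2)"
  shows "integrable M (\<lambda>\<omega>. (cmod (X \<omega> $ i))\<^sup>2)"
  by (rule Bochner_Integration.integrable_bound[OF int])
     (auto intro!: AE_I2 power_mono Finite_Cartesian_Product.norm_nth_le)

lemma integrable_nth_products:
  fixes X Y :: "'a \<Rightarrow> complex^'m"
  assumes [measurable]: "X \<in> borel_measurable M" "Y \<in> borel_measurable M"
    and "integrable M (\<lambda>\<omega>. (norm (X \<omega>))\<^sup>2)" "integrable M (\<lambda>\<omega>. (norm (Y \<omega>))\<^sup>2)"
  shows "integrable M (\<lambda>\<omega>. X \<omega> $ i * cnj (Y \<omega> $ j))"
  using square_integrable_nth[of X] square_integrable_nth[of Y] assms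
  by (intro integrable_mult_of_squares) simp_all

text \<open>The expectation is the quadratic form a^H E[X X^H] a, with the covariance a multiple of
  the identity. It gives the sensing power and the variance of real projections.\<close>

lemma isotropic_herm_prod_const:
  assumes "isotropic c X"
  shows "integrable M (\<lambda>\<omega>. (cmod (herm_prod (X \<omega>) a))\<^sup>2)"
    and "(LINT \<omega>|M. (cmod (herm_prod (X \<omega>) a))\<^sup>2) = c * (norm a)\<^sup>2"
proof -
  have [measurable]: "X \<in> borel_measurable M" and sq: "integrable M (\<lambda>\<omega>. (norm (X \<omega>))\<^sup>2)"
    and cov: "\<And>i j. (LINT \<omega>|M. X \<omega> $ i * cnj (X \<omega> $ j)) = (if i = j then of_real c else 0)"
    using assms by (auto simp: isotropic_def)
  have int: "integrable M (\<lambda>\<omega>. X \<omega> $ i * cnj (X \<omega> $ j))" for i j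
    using sq by (intro integrable_nth_products) simp_all
  have "integrable M (\<lambda>\<omega>. complex_of_real ((cmod (herm_prod (X \<omega>) a))\<^sup>2))"
    unfolding cmod_herm_prod_squared
    by (intro Bochner_Integration.integrable_sum integrable_mult_left int)
  then show "integrable M (\<lambda>\<omega>. (cmod (herm_prod (X \<omega>) a))\<^sup>2)"
    by (simp only: complex_of_real_integrable_eq)
  have "complex_of_real (LINT \<omega>|M. (cmod (herm_prod (X \<omega>) a))\<^sup>2)
      = (LINT \<omega>|M. complex_of_real ((cmod (herm_prod (X \<omega>) a))\<^sup>2))"
    by (rule integral_complex_of_real[symmetric])
  \<comment> \<open>Isotropy annihilates the off-diagonal summands.\<close>
  also have "\<dots> = (\<Sum>i\<in>UNIV. \<Sum>j\<in>UNIV. (if j = i then of_real c else 0) * (a $ i * cnj (a $ j)))"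
    unfolding cmod_herm_prod_squared by (simp add: int cov integrable_mult_left)
  also have "\<dots> = (\<Sum>i\<in>UNIV. of_real c * of_real ((cmod (a $ i))\<^sup>2))"
    by (simp add: if_distrib[of "\<lambda>x. x * _"] complex_norm_square[symmetric] cong: if_cong)
  also have "\<dots> = of_real (c * (norm a)\<^sup>2)"
    unfolding norm_power2_vec by (simp add: sum_distrib_left)
  finally show "(LINT \<omega>|M. (cmod (herm_prod (X \<omega>) a))\<^sup>2) = c * (norm a)\<^sup>2"
    by (simp only: of_real_eq_iff)
qed

lemma isotropic_norm_squared:
  fixes X :: "'a \<Rightarrow> complex^'m"
  assumes "isotropic c X"
  shows "(LINT \<omega>|M. (norm (X \<omega>))\<^sup>2) = c * real CARD('m)"
proof -
  have [measurable]: "X \<in> borel_measurable M" and sq: "integrable M (\<lambda>\<omega>. (norm (X \<omega>))\<^sup>2)"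
    and cov: "\<And>i j. (LINT \<omega>|M. X \<omega> $ i * cnj (X \<omega> $ j)) = (if i = j then of_real c else 0)"
    using assms by (auto simp: isotropic_def)
  have "complex_of_real (LINT \<omega>|M. (cmod (X \<omega> $ i))\<^sup>2) = of_real c" for i
    using cov[of i i] by (simp only: integral_complex_of_real[symmetric] complex_norm_square if_True simp_thms)
  then have "(LINT \<omega>|M. (cmod (X \<omega> $ i))\<^sup>2) = c" for i
    by (simp only: of_real_eq_iff)
  then show ?thesis
    unfolding norm_power2_vec using square_integrable_nth[OF _ sq] by (simp add: mult.commute)
qed

text \<open>Multiplication by i carries the imaginary part of a^H X, up to sign, into a real part.
  Thus |X^H a|^2 splits into two squares of equal mean, each carrying half of the total
  \<open>c * (norm a)\<^sup>2\<close>.\<close>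

lemma circ_complex_normal_inner_variance:
  assumes X: "circ_complex_normal M (mat (complex_of_real c)) X"
  shows "(LINT \<omega>|M. (a \<bullet> X \<omega>)\<^sup>2) = c * (norm a)\<^sup>2 / 2"
proof -
  have eq: "(cmod (herm_prod (X \<omega>) a))\<^sup>2 = (a \<bullet> X \<omega>)\<^sup>2 + (a \<bullet> (cis (pi/2) *s X \<omega>))\<^sup>2" for \<omega>
    by (subst herm_prod_commute)
       (simp add: inner_eq_Re_herm_prod herm_prod_scale_right cmod_power2)
  have mean2: "(LINT \<omega>|M. (a \<bullet> (cis (pi/2) *s X \<omega>))\<^sup>2) = (LINT \<omega>|M. (a \<bullet> X \<omega>)\<^sup>2)"
    by (rule circ_complex_normal_rotate[OF X, of "\<lambda>x. (a \<bullet> x)\<^sup>2"]) simp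
  have int: "integrable M (\<lambda>\<omega>. (a \<bullet> X \<omega>)\<^sup>2)"
    by (rule circ_complex_normal_inner_moments(1)[OF X])
  \<comment> \<open>The second square is the integrable total minus the integrable first
    square.\<close>
  have int2: "integrable M (\<lambda>\<omega>. (a \<bullet> (cis (pi/2) *s X \<omega>))\<^sup>2)"
    using Bochner_Integration.integrable_diff
      [OF isotropic_herm_prod_const(1)[OF circ_complex_normal_isotropic[OF X], of a] int]
    by (simp add: eq)
  show ?thesis
    using isotropic_herm_prod_const(2)[OF circ_complex_normal_isotropic[OF X], of a]
    unfolding eq Bochner_Integration.integral_add[OF int int2] mean2 by simp
qed

lemma circ_complex_normal_norm_power4:
  fixes X :: "'a \<Rightarrow> complex^'m"
  assumes X: "circ_complex_normal M (mat (complex_of_real c)) X"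
  shows "(LINT \<omega>|M. (norm (X \<omega>)) ^ 4) = c\<^sup>2 * real CARD('m) * (real CARD('m) + 1)"
proof -
  note int = circ_complex_normal_inner_moments(1)[OF X]
  have E4: "(LINT \<omega>|M. (a \<bullet> X \<omega>) ^ 4) = 3 / 4 * c\<^sup>2 * (norm a) ^ 4" for a
    using circ_complex_normal_inner_moments(2)[OF X, of a]
    by (simp add: circ_complex_normal_inner_variance[OF X] power_divide power_mult_distrib)
  \<comment> \<open>The real basis vectors are orthonormal: the diagonal case is a pure fourth
    moment, and the off-diagonal case follows by polarization from the projections onto a + b and a
    - b.\<close>
  have E22: "(LINT \<omega>|M. (a \<bullet> X \<omega>)\<^sup>2 * (b \<bullet> X \<omega>)\<^sup>2) = (if a = b then 3 else 1) * c\<^sup>2 / 4"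
    if ab: "a \<in> Basis" "b \<in> Basis" for a b
  proof (cases "a = b")
    case True
    then show ?thesis using E4[of a] ab by (simp flip: power_add)
  next
    case False
    have n: "(norm (a + b))\<^sup>2 = 2" "(norm (a - b))\<^sup>2 = 2"
      using ab False
      by (simp_all add: power2_norm_eq_inner inner_simps inner_Basis)
    have n4: "(norm (a + b)) ^ 4 = 4" "(norm (a - b)) ^ 4 = 4"
      using arg_cong[OF n(1), of "\<lambda>x. x\<^sup>2"] arg_cong[OF n(2), of "\<lambda>x. x\<^sup>2"] by simp_all
    have polar: "u\<^sup>2 * v\<^sup>2 = ((u + v) ^ 4 + (u - v) ^ 4 - 2 * u ^ 4 - 2 * v ^ 4) / 12" for u v :: real
      by (simp add: power2_eq_square power4_eq_xxxx algebra_simps)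
    have "(LINT \<omega>|M. (a \<bullet> X \<omega>)\<^sup>2 * (b \<bullet> X \<omega>)\<^sup>2) =
        (LINT \<omega>|M. (((a + b) \<bullet> X \<omega>) ^ 4 + ((a - b) \<bullet> X \<omega>) ^ 4
          - 2 * (a \<bullet> X \<omega>) ^ 4 - 2 * (b \<bullet> X \<omega>) ^ 4) / 12)"
      unfolding polar by (simp add: inner_simps)
    \<comment> \<open>The fourth powers of the four norms are 4, 4, 1, 1, and (3/4)(4 + 4 - 2 -
      2)/12 = 1/4.\<close>
    also have "\<dots> = c\<^sup>2 / 4"
      using ab by (simp add: int E4 n4)
    finally show ?thesis using False by simp
  qed
  have "(LINT \<omega>|M. (norm (X \<omega>)) ^ 4)
      = (\<Sum>a\<in>Basis. \<Sum>b\<in>(Basis :: (complex^'m) set). (if a = b then 3 else 1) * c\<^sup>2 / 4)"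
    unfolding norm_power4_eq_sum
    by (simp add: circ_complex_normal_integrable_inner_squares[OF X] E22)
  \<comment> \<open>With 3/4 = 1/4 + 1/2, the double sum is a constant plus a diagonal correction.
    The real dimension is 2m, so the total is c^2 ((2m)^2/4 + 2m/2) = c^2 m (m + 1).\<close>
  also have "\<dots> = (\<Sum>a\<in>Basis. \<Sum>b\<in>(Basis :: (complex^'m) set).
      c\<^sup>2 / 4 + (if a = b then c\<^sup>2 / 2 else 0))"
    by (intro sum.cong refl) auto
  also have "\<dots> = c\<^sup>2 * real CARD('m) * (real CARD('m) + 1)"
    by (simp add: sum.distrib algebra_simps power2_eq_square)
  finally show ?thesis .
qed

section \<open>Hermitian products and sums of independent vectors\<close>

lemma integrable_nth:
  fixes X :: "'a \<Rightarrow> complex^'m"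
  assumes "integrable M X"
  shows "integrable M (\<lambda>\<omega>. X \<omega> $ i)"
  using integrable_bounded_linear[OF bounded_linear_vec_nth assms] .

lemma indep_var_borel_measurable:
  assumes "indep_var borel X borel Y"
  shows "X \<in> borel_measurable M" "Y \<in> borel_measurable M"
  using indep_var_rv1[OF assms] indep_var_rv2[OF assms] .

text \<open>Independence factors the expectation entry by entry, and the mean of X kills every
  factorized term.\<close>

lemma indep_var_herm_prod:
  fixes X Y :: "'a \<Rightarrow> complex^'m"
  assumes ind: "indep_var borel X borel Y" and X: "integrable M X" and Y: "integrable M Y"
    and mean: "\<And>i. (LINT \<omega>|M. X \<omega> $ i) = 0"
  shows "integrable M (\<lambda>\<omega>. herm_prod (X \<omega>) (Y \<omega>))"
    and "(LINT \<omega>|M. herm_prod (X \<omega>) (Y \<omega>)) = 0"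
proof -
  have ind': "indep_var borel (\<lambda>\<omega>. cnj (X \<omega> $ i)) borel (\<lambda>\<omega>. Y \<omega> $ i)" for i
    using indep_var_compose[OF ind, of "\<lambda>x. cnj (x $ i)" borel "\<lambda>y. y $ i" borel]
    by (simp add: comp_def)
  have X': "integrable M (\<lambda>\<omega>. cnj (X \<omega> $ i))" and Y': "integrable M (\<lambda>\<omega>. Y \<omega> $ i)" for i
    using integrable_nth[OF X] integrable_nth[OF Y] by simp_all
  show "integrable M (\<lambda>\<omega>. herm_prod (X \<omega>) (Y \<omega>))"
    unfolding herm_prod_def
    by (intro Bochner_Integration.integrable_sum indep_var_integrable ind' X' Y')
  show "(LINT \<omega>|M. herm_prod (X \<omega>) (Y \<omega>)) = 0"
    unfolding herm_prod_def
    by (simp add: indep_var_integrable[OF ind' X' Y'] indep_var_lebesgue_integral[OF ind' X' Y'] mean)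
qed

text \<open>By independence the expectation is the trace of E[X X^H] E[Y Y^H]; the first factor is c
  times the identity, which leaves c times the trace of E[Y Y^H].\<close>

lemma indep_var_isotropic_herm_prod:
  fixes X Y :: "'a \<Rightarrow> complex^'m"
  assumes ind: "indep_var borel X borel Y" and X: "isotropic c X"
    and Y: "integrable M (\<lambda>\<omega>. (norm (Y \<omega>))\<^sup>2)"
  shows "integrable M (\<lambda>\<omega>. (cmod (herm_prod (X \<omega>) (Y \<omega>)))\<^sup>2)"
    and "(LINT \<omega>|M. (cmod (herm_prod (X \<omega>) (Y \<omega>)))\<^sup>2) = c * (LINT \<omega>|M. (norm (Y \<omega>))\<^sup>2)"
proof -
  note [measurable] = indep_var_borel_measurable[OF ind]
  have sq: "integrable M (\<lambda>\<omega>. (norm (X \<omega>))\<^sup>2)"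
    and cov: "\<And>i j. (LINT \<omega>|M. X \<omega> $ i * cnj (X \<omega> $ j)) = (if i = j then of_real c else 0)"
    using X by (auto simp: isotropic_def)
  have X': "integrable M (\<lambda>\<omega>. X \<omega> $ j * cnj (X \<omega> $ i))"
    and Y': "integrable M (\<lambda>\<omega>. Y \<omega> $ i * cnj (Y \<omega> $ j))" for i j
    using sq Y by (auto intro!: integrable_nth_products)
  have ind': "indep_var borel (\<lambda>\<omega>. X \<omega> $ j * cnj (X \<omega> $ i)) borel (\<lambda>\<omega>. Y \<omega> $ i * cnj (Y \<omega> $ j))"
    for i j
    using indep_var_compose[OF ind, of "\<lambda>x. x $ j * cnj (x $ i)" borel
        "\<lambda>y. y $ i * cnj (y $ j)" borel]
    by (simp add: comp_def)
  note int = indep_var_integrable[OF ind' X' Y']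
  have "integrable M (\<lambda>\<omega>. complex_of_real ((cmod (herm_prod (X \<omega>) (Y \<omega>)))\<^sup>2))"
    unfolding cmod_herm_prod_squared by (intro Bochner_Integration.integrable_sum int)
  then show "integrable M (\<lambda>\<omega>. (cmod (herm_prod (X \<omega>) (Y \<omega>)))\<^sup>2)"
    by (simp only: complex_of_real_integrable_eq)
  have sqY: "integrable M (\<lambda>\<omega>. (cmod (Y \<omega> $ i))\<^sup>2)" for i
    using square_integrable_nth[OF _ Y] by simp
  have "complex_of_real (LINT \<omega>|M. (cmod (herm_prod (X \<omega>) (Y \<omega>)))\<^sup>2)
      = (LINT \<omega>|M. complex_of_real ((cmod (herm_prod (X \<omega>) (Y \<omega>)))\<^sup>2))"
    by (rule integral_complex_of_real[symmetric])
  also have "\<dots> = (\<Sum>i\<in>UNIV. \<Sum>j\<in>UNIV.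
      (if j = i then of_real c else 0) * (LINT \<omega>|M. Y \<omega> $ i * cnj (Y \<omega> $ j)))"
    unfolding cmod_herm_prod_squared
    by (simp add: int indep_var_lebesgue_integral[OF ind' X' Y'] cov)
  also have "\<dots> = (\<Sum>i\<in>UNIV. of_real (c * (LINT \<omega>|M. (cmod (Y \<omega> $ i))\<^sup>2)))"
    by (simp add: if_distrib[of "\<lambda>x. x * _"] complex_norm_square[symmetric]
        flip: of_real_power cong: if_cong)
  also have "\<dots> = of_real (c * (LINT \<omega>|M. (norm (Y \<omega>))\<^sup>2))"
    unfolding norm_power2_vec by (simp add: sqY sum_distrib_left)
  finally show "(LINT \<omega>|M. (cmod (herm_prod (X \<omega>) (Y \<omega>)))\<^sup>2) = c * (LINT \<omega>|M. (norm (Y \<omega>))\<^sup>2)"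
    by (simp only: of_real_eq_iff)
qed

lemma integrable_of_norm_squared:
  fixes X :: "'a \<Rightarrow> 'b::{second_countable_topology, banach}"
  assumes [measurable]: "X \<in> borel_measurable M" and "integrable M (\<lambda>\<omega>. (norm (X \<omega>))\<^sup>2)"
  shows "integrable M X"
  using integrable_norm_power_le[OF assms, of 1] by (simp add: integrable_norm_iff)

text \<open>Both cross-covariances vanish by independence and the zero mean of Y, so the covariances
  add. Applied to a scaled estimate plus its error, this gives the channel covariance.\<close>

lemma isotropic_scaleR_add:
  fixes X Y :: "'a \<Rightarrow> complex^'m"
  assumes ind: "indep_var borel X borel Y" and X: "isotropic a X" and Y: "isotropic b Y"
    and mean: "\<And>i. (LINT \<omega>|M. Y \<omega> $ i) = 0"
  shows "isotropic (r\<^sup>2 * a + b) (\<lambda>\<omega>. r *\<^sub>R X \<omega> + Y \<omega>)"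
proof -
  note meas [measurable] = indep_var_borel_measurable[OF ind]
  have sqX: "integrable M (\<lambda>\<omega>. (norm (X \<omega>))\<^sup>2)" and sqY: "integrable M (\<lambda>\<omega>. (norm (Y \<omega>))\<^sup>2)"
    and cX: "\<And>i j. (LINT \<omega>|M. X \<omega> $ i * cnj (X \<omega> $ j)) = (if i = j then of_real a else 0)"
    and cY: "\<And>i j. (LINT \<omega>|M. Y \<omega> $ i * cnj (Y \<omega> $ j)) = (if i = j then of_real b else 0)"
    using X Y by (auto simp: isotropic_def)
  have ints: "integrable M (\<lambda>\<omega>. X \<omega> $ i * cnj (X \<omega> $ j))" "integrable M (\<lambda>\<omega>. Y \<omega> $ i * cnj (Y \<omega> $ j))"
    "integrable M (\<lambda>\<omega>. X \<omega> $ i * cnj (Y \<omega> $ j))" "integrable M (\<lambda>\<omega>. Y \<omega> $ i * cnj (X \<omega> $ j))" for i j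
    by (auto intro!: integrable_nth_products sqX sqY)
  have ind': "indep_var borel (\<lambda>\<omega>. X \<omega> $ i) borel (\<lambda>\<omega>. cnj (Y \<omega> $ j))" for i j
    using indep_var_compose[OF ind, of "\<lambda>x. x $ i" borel "\<lambda>y. cnj (y $ j)" borel]
    by (simp add: comp_def)
  have cXY: "(LINT \<omega>|M. X \<omega> $ i * cnj (Y \<omega> $ j)) = 0" for i j
    using integrable_nth[OF integrable_of_norm_squared[OF meas(1) sqX], of i]
      integrable_nth[OF integrable_of_norm_squared[OF meas(2) sqY], of j]
    by (subst indep_var_lebesgue_integral[OF ind']) (simp_all add: mean)
  \<comment> \<open>The opposite cross term is the conjugate of the previous one with the indices
    exchanged.\<close>
  have cYX: "(LINT \<omega>|M. Y \<omega> $ i * cnj (X \<omega> $ j)) = 0" for i j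
  proof -
    have "(LINT \<omega>|M. Y \<omega> $ i * cnj (X \<omega> $ j)) = cnj (LINT \<omega>|M. X \<omega> $ j * cnj (Y \<omega> $ i))"
      by (subst Bochner_Integration.integral_cnj[symmetric]) (simp add: mult.commute)
    then show ?thesis by (simp add: cXY)
  qed
  have "integrable M (\<lambda>\<omega>. (norm (r *\<^sub>R X \<omega> + Y \<omega>))\<^sup>2)"
  proof (rule Bochner_Integration.integrable_bound)
    show "integrable M (\<lambda>\<omega>. 2 * (r\<^sup>2 * (norm (X \<omega>))\<^sup>2 + (norm (Y \<omega>))\<^sup>2))"
      using sqX sqY by simp
    have "(norm (r *\<^sub>R x + y))\<^sup>2 \<le> 2 * (r\<^sup>2 * (norm x)\<^sup>2 + (norm y)\<^sup>2)" for x y :: "complex^'m"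
    proof -
      have "(norm (r *\<^sub>R x + y))\<^sup>2 \<le> (norm (r *\<^sub>R x) + norm y)\<^sup>2"
        by (intro power_mono norm_triangle_ineq) simp
      also have "\<dots> \<le> 2 * ((norm (r *\<^sub>R x))\<^sup>2 + (norm y)\<^sup>2)"
        using sum_squares_bound[of "norm (r *\<^sub>R x)" "norm y"] by (simp add: power2_sum)
      finally show ?thesis by (simp add: power_mult_distrib)
    qed
    then show "AE \<omega> in M. norm ((norm (r *\<^sub>R X \<omega> + Y \<omega>))\<^sup>2)
        \<le> norm (2 * (r\<^sup>2 * (norm (X \<omega>))\<^sup>2 + (norm (Y \<omega>))\<^sup>2))"
      by simp
  qed simp
  moreover have "(LINT \<omega>|M. (r *\<^sub>R X \<omega> + Y \<omega>) $ i * cnj ((r *\<^sub>R X \<omega> + Y \<omega>) $ j))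
      = (if i = j then of_real (r\<^sup>2 * a + b) else 0)" for i j
  proof -
    have "(r *\<^sub>R X \<omega> + Y \<omega>) $ i * cnj ((r *\<^sub>R X \<omega> + Y \<omega>) $ j) =
        of_real (r\<^sup>2) * (X \<omega> $ i * cnj (X \<omega> $ j)) + of_real r * (X \<omega> $ i * cnj (Y \<omega> $ j))
        + of_real r * (Y \<omega> $ i * cnj (X \<omega> $ j)) + Y \<omega> $ i * cnj (Y \<omega> $ j)" for \<omega>
      by (simp add: scaleR_conv_of_real[where 'a=complex] power2_eq_square algebra_simps)
    then show ?thesis
      by (simp add: ints cX cY cXY cYX del: of_real_power)
  qed
  ultimately show ?thesis by (simp add: isotropic_def)
qed

text \<open>The gain is r |X|^2 + Y^H X, where the second summand has mean zero. In the power, r^2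
  E|X|^4 and E|Y^H X|^2 survive, while the mixed term 2 r |X|^2 Re(Y^H X) averages to zero.\<close>

lemma circ_complex_normal_matched_gain:
  fixes X Y :: "'a \<Rightarrow> complex^'m"
  assumes ind: "indep_var borel Y borel X"
    and X: "circ_complex_normal M (mat 1) X"
    and Y: "circ_complex_normal M (mat (complex_of_real b)) Y"
  defines "m \<equiv> real CARD('m)"
  shows "(LINT \<omega>|M. herm_prod (r *\<^sub>R X \<omega> + Y \<omega>) (X \<omega>)) = of_real (r * m)" (is ?mean)
    and "(LINT \<omega>|M. (cmod (herm_prod (r *\<^sub>R X \<omega> + Y \<omega>) (X \<omega>)))\<^sup>2) = r\<^sup>2 * (m * (m + 1)) + b * m"
      (is ?power)
proof -
  note [measurable] = indep_var_borel_measurable[OF ind]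
  have X1: "circ_complex_normal M (mat (complex_of_real 1)) X" using X by simp
  note isoX = circ_complex_normal_isotropic[OF X1] and isoY = circ_complex_normal_isotropic[OF Y]
  have intX: "integrable M (\<lambda>\<omega>. (norm (X \<omega>)) ^ n)" if "n \<le> 4" for n
    by (rule circ_complex_normal_integrable_norm_power[OF X that])
  have "integrable M X" "integrable M Y"
    using intX[of 2] circ_complex_normal_integrable_norm_power[OF Y, of 2]
    by (auto intro!: integrable_of_norm_squared)
  note cross = indep_var_herm_prod[OF ind this(2,1) circ_complex_normal_nth_mean[OF Y]]
  \<comment> \<open>The weight |X|^2 of the mixed term is absorbed into the second argument: |X|^2 X
    is still independent of Y, and it is integrable by the third moment of the norm. The zero-mean
    lemma for independent vectors then applies.\<close>
  have "(\<lambda>\<omega>. (norm (X \<omega>))\<^sup>2 *\<^sub>R X \<omega>) \<in> borel_measurable M" by measurable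
  moreover have "integrable M (\<lambda>\<omega>. norm ((norm (X \<omega>))\<^sup>2 *\<^sub>R X \<omega>))"
    using intX[of 3] by (simp add: power2_eq_square power3_eq_cube)
  ultimately have "integrable M (\<lambda>\<omega>. (norm (X \<omega>))\<^sup>2 *\<^sub>R X \<omega>)"
    by (simp only: integrable_norm_iff)
  moreover have "indep_var borel Y borel (\<lambda>\<omega>. (norm (X \<omega>))\<^sup>2 *\<^sub>R X \<omega>)"
    using indep_var_compose[OF ind, of "\<lambda>y. y" borel "\<lambda>x. (norm x)\<^sup>2 *\<^sub>R x" borel]
    by (simp add: comp_def)
  ultimately have cross3:
    "integrable M (\<lambda>\<omega>. herm_prod (Y \<omega>) ((norm (X \<omega>))\<^sup>2 *\<^sub>R X \<omega>))"
    "(LINT \<omega>|M. herm_prod (Y \<omega>) ((norm (X \<omega>))\<^sup>2 *\<^sub>R X \<omega>)) = 0"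
    using indep_var_herm_prod[OF _ \<open>integrable M Y\<close> _ circ_complex_normal_nth_mean[OF Y]] by blast+
  have gain: "herm_prod (r *\<^sub>R x + y) x = of_real (r * (norm x)\<^sup>2) + herm_prod y x"
    for x y :: "complex^'m"
    by (simp add: herm_prod_add_left herm_prod_scaleR_left herm_prod_self)
  have E2: "(LINT \<omega>|M. (norm (X \<omega>))\<^sup>2) = m"
    using isotropic_norm_squared[OF isoX] by (simp add: m_def)
  show ?mean
    unfolding gain using intX[of 2] cross E2 by (simp del: of_real_mult of_real_power)
  have expand: "(cmod (herm_prod (r *\<^sub>R x + y) x))\<^sup>2 = r\<^sup>2 * (norm x) ^ 4
      + 2 * r * Re (herm_prod y ((norm x)\<^sup>2 *\<^sub>R x)) + (cmod (herm_prod y x))\<^sup>2"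
    for x y :: "complex^'m"
    unfolding gain herm_prod_scaleR_right cmod_power2
    by (simp add: power2_eq_square power4_eq_xxxx algebra_simps)
  have "(LINT \<omega>|M. (norm (X \<omega>)) ^ 4) = m * (m + 1)"
    using circ_complex_normal_norm_power4[OF X1] by (simp add: m_def)
  moreover have "(LINT \<omega>|M. Re (herm_prod (Y \<omega>) ((norm (X \<omega>))\<^sup>2 *\<^sub>R X \<omega>))) = 0"
    using integral_Re[OF cross3(1)] cross3(2) by simp
  moreover note indep_var_isotropic_herm_prod[OF ind isoY intX[of 2]]
  ultimately show ?power
    unfolding expand using intX[of 4] integrable_Re[OF cross3(1)] E2
    by simp
qed

end

section \<open>Evaluation of the SINR terms for MR precoding\<close>

theorem proposition1:
  fixes M :: "'a measure"
    and gbar e :: "'k::finite \<Rightarrow> 'a \<Rightarrow> complex^'m"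
    and \<rho> \<alpha> \<eta> \<epsilon> \<xi> \<sigma> :: "'k \<Rightarrow> real"
    and \<rho>sen q :: real
    and w :: "complex^'m"
    and k :: 'k
  assumes "prob_space M"
    and "\<And>i. \<rho> i \<in> {0, 1}"
    and "\<rho>sen \<in> {0, 1}"
    and "\<And>i. \<alpha> i \<ge> 0"
    and "q \<ge> 0"
    and "norm w = 1"
    and "\<And>i. \<eta> i > 0"
    and "\<And>i. \<epsilon> i \<ge> 0"
    and "\<And>i. \<xi> i = \<eta> i + \<epsilon> i"
    and "\<And>i. (\<sigma> i)\<^sup>2 > 0"
    and "\<And>i. circ_complex_normal M (mat 1) (gbar i)"
    and "\<And>i. circ_complex_normal M (mat (complex_of_real (\<epsilon> i))) (e i)"
    and "prob_space.indep_vars M (\<lambda>_. borel) (case_sum gbar e) UNIV"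
  shows "uatf_sinr M \<rho> \<rho>sen q w \<sigma> (channel \<eta> gbar e) (mr_precoder \<alpha> gbar) k =
    real CARD('m) * \<eta> k * \<rho> k * \<alpha> k /
      (\<xi> k * (\<Sum>i\<in>UNIV. \<rho> i * \<alpha> i) + \<xi> k * \<rho>sen * q + (\<sigma> k)\<^sup>2)"
proof -
  interpret prob_space M by fact
  note normal_g = assms(11) and normal_e = assms(12) and indep = assms(13)
  define m where "m = real CARD('m)"
  have m: "m > 0" by (simp add: m_def)
  let ?h = "channel \<eta> gbar e"
  have h: "?h k = (\<lambda>\<omega>. sqrt (\<eta> k) *\<^sub>R gbar k \<omega> + e k \<omega>)"
    by (simp add: channel_def channel_estimate_def fun_eq_iff)
  have iso_g: "isotropic 1 (gbar i)" for i
    using normal_g[of i] by (intro circ_complex_normal_isotropic) simp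
  have sq_g: "integrable M (\<lambda>\<omega>. (norm (gbar i \<omega>))\<^sup>2)" for i
    using iso_g[of i] by (simp add: isotropic_def)
  \<comment> \<open>Disjoint blocks of the jointly independent family are independent; projecting
    each block yields the required pair. The constructors \<open>Inl\<close> and \<open>Inr\<close>
    index estimates and errors.\<close>
  have indep_eg: "indep_var borel (e i) borel (gbar i)" for i
    using indep_var_compose[OF indep_var_restrict[OF indep, of "{Inr i}" "{Inl i}"],
        of "\<lambda>f. f (Inr i)" borel "\<lambda>f. f (Inl i)" borel]
    by (simp add: comp_def)
  have indep_ge: "indep_var borel (gbar i) borel (e i)" for i
    using indep_var_compose[OF indep_var_restrict[OF indep, of "{Inl i}" "{Inr i}"],
        of "\<lambda>f. f (Inl i)" borel "\<lambda>f. f (Inr i)" borel]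
    by (simp add: comp_def)
  \<comment> \<open>The channel of user k uses the block \<open>{Inl k, Inr k}\<close>, disjoint
    from \<open>{Inl i}\<close> exactly because i differs from k.\<close>
  have indep_hg: "indep_var borel (?h k) borel (gbar i)" if "i \<noteq> k" for i
    using that indep_var_compose[OF indep_var_restrict[OF indep, of "{Inl k, Inr k}" "{Inl i}"],
        of "\<lambda>f. sqrt (\<eta> k) *\<^sub>R f (Inl k) + f (Inr k)" borel "\<lambda>f. f (Inl i)" borel]
    by (simp add: comp_def h)
  have iso_h: "isotropic (\<xi> k) (?h k)"
    using isotropic_scaleR_add[OF indep_ge iso_g circ_complex_normal_isotropic[OF normal_e]
        circ_complex_normal_nth_mean[OF normal_e], of "sqrt (\<eta> k)"] assms(7)[of k] assms(9)[of k]
    by (simp add: h)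
  \<comment> \<open>Scheduling indicators are idempotent, so they appear linearly in the
    powers.\<close>
  have \<rho>_sq: "(\<rho> i)\<^sup>2 = \<rho> i" for i using assms(2)[of i] by auto
  have gain: "comm_gain \<rho> ?h (mr_precoder \<alpha> gbar) k i \<omega>
      = of_real (\<rho> i * sqrt (\<alpha> i / m)) * herm_prod (?h k \<omega>) (gbar i \<omega>)" for i \<omega>
    by (simp add: comm_gain_def mr_precoder_def herm_prod_scaleR_right m_def)
  have gain_sq: "(cmod (comm_gain \<rho> ?h (mr_precoder \<alpha> gbar) k i \<omega>))\<^sup>2
      = \<rho> i * \<alpha> i / m * (cmod (herm_prod (?h k \<omega>) (gbar i \<omega>)))\<^sup>2" for i \<omega>
    using assms(4)[of i] m
    by (simp add: gain norm_mult power_mult_distrib \<rho>_sq del: of_real_mult)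
  have A: "(cmod (LINT \<omega>|M. comm_gain \<rho> ?h (mr_precoder \<alpha> gbar) k k \<omega>))\<^sup>2 = m * \<eta> k * \<rho> k * \<alpha> k"
    using circ_complex_normal_matched_gain(1)[OF indep_eg[of k] normal_g normal_e, of "sqrt (\<eta> k)"]
      assms(4,7)[of k] m
    by (simp add: gain h norm_mult power_mult_distrib \<rho>_sq flip: m_def of_real_mult)
       (simp add: power2_eq_square)
  \<comment> \<open>From (1/m)(\<open>\<eta> k\<close> m (m + 1) + \<open>\<epsilon> k\<close> m) =
    m \<open>\<eta> k\<close> + \<open>\<xi> k\<close>: the first part is the squared mean, the
    second the self-interference.\<close>
  have A2: "(LINT \<omega>|M. (cmod (comm_gain \<rho> ?h (mr_precoder \<alpha> gbar) k k \<omega>))\<^sup>2)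
      = m * \<eta> k * \<rho> k * \<alpha> k + \<xi> k * (\<rho> k * \<alpha> k)"
    using circ_complex_normal_matched_gain(2)[OF indep_eg[of k] normal_g normal_e, of "sqrt (\<eta> k)"]
      assms(7)[of k] m
    by (simp add: gain_sq h assms(9) field_simps flip: m_def)
  have B: "(LINT \<omega>|M. (cmod (comm_gain \<rho> ?h (mr_precoder \<alpha> gbar) k i \<omega>))\<^sup>2) = \<xi> k * (\<rho> i * \<alpha> i)"
    if "i \<noteq> k" for i
    using indep_var_isotropic_herm_prod(2)[OF indep_hg[OF that] iso_h sq_g] isotropic_norm_squared[OF iso_g] m
    by (simp add: gain_sq flip: m_def)
  have C: "(LINT \<omega>|M. (cmod (sensing_gain \<rho>sen q w ?h k \<omega>))\<^sup>2) = \<xi> k * \<rho>sen * q"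
    using isotropic_herm_prod_const(2)[OF iso_h, of w] assms(3,5,6)
    by (auto simp: sensing_gain_def norm_mult power_mult_distrib)
  have "(\<Sum>i\<in>UNIV - {k}. LINT \<omega>|M. (cmod (comm_gain \<rho> ?h (mr_precoder \<alpha> gbar) k i \<omega>))\<^sup>2)
      = (\<Sum>i\<in>UNIV - {k}. \<xi> k * (\<rho> i * \<alpha> i))"
    by (intro sum.cong refl B) simp
  also have "\<dots> = \<xi> k * (\<Sum>i\<in>UNIV. \<rho> i * \<alpha> i) - \<xi> k * (\<rho> k * \<alpha> k)"
    by (simp add: sum_distrib_left sum_diff1)
  \<comment> \<open>Subtracting the squared mean of A leaves
    \<open>\<xi> k * (\<rho> k * \<alpha> k)\<close>, exactly the summand missing from the
    interference over i different from k, so the sum in the denominator runs over all users.\<close>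
  finally show ?thesis
    unfolding uatf_sinr_def Let_def A A2 C m_def[symmetric] by simp
qed

end
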